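(* For every $k\in\mathbb{C}$, the formal power series $\Theta_k$ satisfies $$\mathfrak{T}^2\Theta_k(x)=\frac{\Theta_k(2x)}{2},$$ where $\mathfrak{T}^2=\mathfrak{T}\circ\mathfrak{T}$.
   Context: Let $x+x^2\mathbb{C}[[x]]$ denote the set of formal power series with zero constant term and linear coefficient $1$. For $f$ in this set, $\mathfrak{T}f:=f/f'$ (again an element of $x+x^2\mathbb{C}[[x]]$), and $f^{inv}$ denotes the compositional inverse of $f$. For $k\in\mathbb{C}$, $\Theta_k\in x+x^2\mathbb{C}[[x]]$ (the Jacobi elliptic function $\mathrm{sn}$) is defined by $$\Theta_k^{inv}(x)=\int_0^x\frac{dt}{\sqrt{1-t^2}\sqrt{1-k^2t^2}},$$ the integrand being expanded as a formal power series in $t$ via the binomial series. *)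

theory Defs
  imports Complex_Main "HOL-Computational_Algebra.Formal_Power_Series"
begin

text \<open>The set of complex formal power series \<open>x + x\<^sup>2 \<complex>[[x]]\<close>.\<close>

definition normalized_fps :: "complex fps set" where
  "normalized_fps = {f. fps_nth f 0 = 0 \<and> fps_nth f 1 = 1}"

text \<open>
  Only meant for \<open>f \<in> normalized_fps\<close>, where \<open>f'\<close> has constant term 1, so that the
  division is multiplication by the inverse of a unit of the power series ring.
\<close>

definition T_op :: "complex fps \<Rightarrow> complex fps" where
  "T_op f = f / fps_deriv f"

text \<open>
  \<open>sqrt (1 + u)\<close> by the binomial series, for \<open>u\<close> with zero constant term.
\<close>

definition fps_sqrt1p :: "complex fps \<Rightarrow> complex fps" where
  "fps_sqrt1p u = fps_binomial (1/2) oo u"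

definition Theta_integral :: "complex \<Rightarrow> complex fps" where
  "Theta_integral k =
     fps_integral0 (1 / (fps_sqrt1p (- (fps_X ^ 2)) *
                         fps_sqrt1p (- (fps_const (k ^ 2) * fps_X ^ 2))))"

text \<open>
  \<open>\<Theta>\<^sub>k\<close> is determined by its compositional inverse; see the lemma \<open>Theta_unique\<close> below.
\<close>

definition Theta :: "complex \<Rightarrow> complex fps" where
  "Theta k = fps_inv (Theta_integral k)"

lemma fps_sqrt1p_square:
  assumes "fps_nth u 0 = 0"
  shows "fps_sqrt1p u ^ 2 = 1 + u"
proof -
  have "fps_binomial (1/2 :: complex) * fps_binomial (1/2) = 1 + fps_X"
    by (simp add: fps_binomial_add_mult [symmetric] fps_binomial_1)
  then have "fps_sqrt1p u * fps_sqrt1p u = (1 + fps_X) oo u"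
    using assms by (simp add: fps_sqrt1p_def fps_compose_mult_distrib [symmetric])
  then show ?thesis
    using assms by (simp add: power2_eq_square fps_compose_add_distrib)
qed

lemma fps_sqrt1p_nth_0: "fps_nth (fps_sqrt1p u) 0 = 1"
  by (simp add: fps_sqrt1p_def)

lemma T_op_normalized:
  assumes "f \<in> normalized_fps"
  shows "T_op f \<in> normalized_fps"
  using assms
  by (auto simp: normalized_fps_def T_op_def fps_divide_unit fps_mult_nth)

lemma Theta_integral_normalized: "Theta_integral k \<in> normalized_fps"
  by (simp add: normalized_fps_def Theta_integral_def fps_divide_unit fps_sqrt1p_nth_0
      fps_integral_def)

lemma Theta_normalized: "Theta k \<in> normalized_fps"
  using Theta_integral_normalized [of k]
  by (auto simp: normalized_fps_def Theta_def fps_inv_def)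

lemma Theta_unique:
  assumes "f \<in> normalized_fps"
  shows "fps_inv f = Theta_integral k \<longleftrightarrow> f = Theta k"
proof -
  have "fps_inv (fps_inv f) = f"
    using assms by (intro fps_inv_idempotent) (auto simp: normalized_fps_def)
  moreover have "fps_inv (fps_inv (Theta_integral k)) = Theta_integral k"
    using Theta_integral_normalized [of k]
    by (intro fps_inv_idempotent) (auto simp: normalized_fps_def)
  ultimately show ?thesis
    unfolding Theta_def by metis
qed

end

theory Submission
  imports Defs
begin

text \<open>
  Write \<open>s = \<Theta>\<^sub>k\<close> and \<open>P = (1 - s\<^sup>2) (1 - k\<^sup>2 s\<^sup>2)\<close>. Then \<open>s'\<^sup>2 = P\<close>, which gives \<open>s''\<close> as a
  polynomial in \<open>s\<close>, and two applications of the quotient rule give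
  \<open>T\<^sup>2 s = s s' / (1 - k\<^sup>2 s\<^sup>4)\<close>. This is half of the right-hand side of the duplication formula
  for \<open>sn\<close>. To prove the latter, one checks that \<open>h = 2 s s' / (1 - k\<^sup>2 s\<^sup>4)\<close> satisfies
  \<open>h'\<^sup>2 = 4 (1 - h\<^sup>2) (1 - k\<^sup>2 h\<^sup>2)\<close>, so that the elliptic integral of \<open>h\<close> has derivative \<open>2\<close>.
\<close>

text \<open>The radicand of the elliptic integral at \<open>f\<close>. Working with squares replaces
  the binomial square roots by polynomial relations; the sign lost in this way is recovered from
  constant terms.\<close>

definition quartic :: "complex \<Rightarrow> complex fps \<Rightarrow> complex fps" where
  "quartic k f = (1 - f ^ 2) * (1 - fps_const (k ^ 2) * f ^ 2)"

lemma deriv_Theta_integral_square: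
  "fps_deriv (Theta_integral k) ^ 2 * quartic k fps_X = 1"
proof -
  define W where "W = fps_sqrt1p (- (fps_X ^ 2)) * fps_sqrt1p (- (fps_const (k ^ 2) * fps_X ^ 2))"
  have W0: "fps_nth W 0 = 1"
    by (simp add: W_def fps_sqrt1p_nth_0)
  have "W ^ 2 = quartic k fps_X"
    by (simp add: W_def quartic_def power_mult_distrib fps_sqrt1p_square)
  moreover have "fps_deriv (Theta_integral k) = inverse W"
    using W0 by (simp add: Theta_integral_def W_def [symmetric] fps_deriv_fps_integral
        fps_divide_unit)
  moreover have "inverse W * W = 1"
    using W0 by (intro inverse_mult_eq_1) simp
  ultimately show ?thesis
    by (metis power_mult_distrib power_one)
qed

lemma quartic_compose:
  assumes "fps_nth f 0 = 0"
  shows "quartic k fps_X oo f = quartic k f"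
  using assms by (simp add: quartic_def fps_compose_mult_distrib fps_compose_sub_distrib
      fps_compose_power [symmetric])

text \<open>Chain rule, after substituting \<open>f\<close> into the preceding identity. Taking
  \<open>f = Theta k\<close> gives the differential equation of \<open>Theta k\<close>; taking
  \<open>f = h\<close> drives \<open>Theta_double_unique\<close>.\<close>

lemma deriv_Theta_integral_compose_square:
  assumes "fps_nth f 0 = 0"
  shows "fps_deriv (Theta_integral k oo f) ^ 2 * quartic k f = fps_deriv f ^ 2"
proof -
  have "(fps_deriv (Theta_integral k) ^ 2 * quartic k fps_X) oo f = 1"
    by (simp add: deriv_Theta_integral_square)
  then have "(fps_deriv (Theta_integral k) oo f) ^ 2 * quartic k f = 1"
    using assms by (simp add: fps_compose_mult_distrib quartic_compose fps_compose_power [symmetric])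
  then show ?thesis
    using assms by (simp add: fps_compose_deriv power_mult_distrib algebra_simps)
qed

lemma Theta_nth_0: "fps_nth (Theta k) 0 = 0"
  and Theta_nth_1: "fps_nth (Theta k) (Suc 0) = 1"
  using Theta_normalized [of k] by (auto simp: normalized_fps_def)

lemma Theta_integral_nth_0: "fps_nth (Theta_integral k) 0 = 0"
  and Theta_integral_nth_1: "fps_nth (Theta_integral k) (Suc 0) = 1"
  using Theta_integral_normalized [of k] by (auto simp: normalized_fps_def)

lemma Theta_integral_Theta: "Theta_integral k oo Theta k = fps_X"
  unfolding Theta_def
  by (rule fps_inv_right) (simp_all add: Theta_integral_nth_0 Theta_integral_nth_1)

lemma Theta_Theta_integral: "Theta k oo Theta_integral k = fps_X"
  unfolding Theta_def
  by (rule fps_inv) (simp_all add: Theta_integral_nth_0 Theta_integral_nth_1)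

lemma deriv_Theta_square: "fps_deriv (Theta k) ^ 2 = quartic k (Theta k)"
  using deriv_Theta_integral_compose_square [OF Theta_nth_0, of k k]
  by (simp add: Theta_integral_Theta)

lemma deriv2_Theta:
  "fps_deriv (fps_deriv (Theta k)) =
     2 * fps_const (k ^ 2) * Theta k ^ 3 - (1 + fps_const (k ^ 2)) * Theta k"
proof -
  define s c m where "s = Theta k" and "c = fps_deriv s" and "m = fps_const (k ^ 2)"
  have "fps_nth c 0 = 1"
    by (simp add: c_def s_def Theta_nth_1)
  \<comment> \<open>Differentiating \<open>c ^ 2\<close> produces the factor \<open>2 * c\<close> on
    both sides; it can be cancelled because power series form an integral domain.\<close>
  then have nz: "2 * c \<noteq> 0"
    by auto
  have "c ^ 2 = (1 - s ^ 2) * (1 - m * s ^ 2)"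
    using deriv_Theta_square by (simp add: c_def s_def m_def quartic_def)
  then have "fps_deriv (c * c) = fps_deriv ((1 - s * s) * (1 - m * (s * s)))"
    by (simp add: power2_eq_square)
  moreover have "fps_deriv m = 0"
    by (simp add: m_def)
  ultimately have "2 * c * fps_deriv c = 2 * c * (2 * m * s ^ 3 - (1 + m) * s)"
    by (simp add: c_def [symmetric] power3_eq_cube) algebra
  with nz show ?thesis
    by (simp add: c_def s_def m_def)
qed

text \<open>Cancelling \<open>quartic k h\<close> shows that the elliptic integral of
  \<open>h\<close> has derivative 2 or -2. The linear coefficient of \<open>h\<close> selects 2, so
  the integral is \<open>2x\<close>, and composing with \<open>Theta k\<close> recovers
  \<open>h\<close>.\<close>

lemma Theta_double_unique:
  assumes "fps_nth h 0 = 0" "fps_nth h 1 = 2" "fps_deriv h ^ 2 = 4 * quartic k h"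
  shows "h = Theta k oo (fps_const 2 * fps_X)"
proof -
  let ?F = "Theta_integral k"
  have "fps_nth (quartic k h) 0 = 1"
    using assms(1) by (simp add: quartic_def power2_eq_square)
  then have "quartic k h \<noteq> 0"
    by auto
  then have "fps_deriv (?F oo h) ^ 2 = 2 ^ 2"
    using deriv_Theta_integral_compose_square [OF assms(1), of k] assms(3) by simp
  then have "fps_deriv (?F oo h) = 2 \<or> fps_deriv (?F oo h) = - 2"
    by (simp only: power2_eq_iff)
  moreover have "fps_nth (fps_deriv (?F oo h)) 0 = 2"
    using assms by (simp add: fps_compose_deriv Theta_integral_nth_1)
  then have "fps_deriv (?F oo h) \<noteq> - 2"
    by (auto simp del: fps_deriv_nth)
  ultimately have "fps_deriv (?F oo h) = fps_deriv (fps_const 2 * fps_X)"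
    by (simp add: numeral_fps_const)
  then have "?F oo h = fps_const 2 * fps_X"
    by (subst (asm) fps_deriv_eq_iff) (simp add: Theta_integral_nth_0)
  moreover have "Theta k oo (?F oo h) = h"
    using assms(1) fps_compose_assoc [of h ?F "Theta k"]
    by (simp add: Theta_integral_nth_0 Theta_Theta_integral)
  ultimately show ?thesis
    by simp
qed

lemma Theta_double:
  "Theta k oo (fps_const 2 * fps_X) =
     2 * (Theta k * fps_deriv (Theta k) / (1 - fps_const (k ^ 2) * Theta k ^ 4))"
proof -
  define s c m where "s = Theta k" and "c = fps_deriv s" and "m = fps_const (k ^ 2)"
  \<comment> \<open>With the inverse named and characterised by \<open>Di\<close>, the identities
    below become polynomial consequences of \<open>Di\<close> and \<open>c2\<close>, within reach of
    \<open>algebra\<close>.\<close>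
  define i where "i = inverse (1 - m * s ^ 4)"
  define h where "h = 2 * s * c * i"
  have s0: "fps_nth s 0 = 0" and c0: "fps_nth c 0 = 1"
    by (simp_all add: s_def c_def Theta_nth_0 Theta_nth_1)
  have D0: "fps_nth (1 - m * s ^ 4) 0 = 1"
    using s0 by (simp add: fps_nth_power_0)
  have i0: "fps_nth i 0 = 1"
    using D0 by (simp add: i_def)
  have Di: "(1 - m * s ^ 4) * i = 1"
    unfolding i_def by (rule inverse_mult_eq_1') (simp only: D0, simp)
  have c2: "c ^ 2 = (1 - s ^ 2) * (1 - m * s ^ 2)"
    using deriv_Theta_square by (simp add: c_def s_def m_def quartic_def)
  have dc: "fps_deriv c = 2 * m * s ^ 3 - (1 + m) * s"
    by (simp add: c_def s_def m_def deriv2_Theta)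
  have dm: "fps_deriv m = 0"
    by (simp add: m_def)
  have ds: "fps_deriv s = c"
    by (simp add: c_def)
  have "(1 - m * s ^ 4) * fps_deriv i = 4 * m * s ^ 3 * c * i"
  proof -
    \<comment> \<open>The fourth power is written out so that the product rule alone differentiates
      it.\<close>
    have "fps_deriv ((1 - m * (s * s * s * s)) * i) = 0"
      using Di by (simp add: power4_eq_xxxx)
    then show ?thesis
      by (simp add: dm ds) algebra
  qed
  then have di: "fps_deriv i = 4 * m * s ^ 3 * c * i ^ 2"
    using Di by algebra
  have dh: "fps_deriv h = 2 * (c ^ 2 + s * fps_deriv c) * i + 8 * m * s ^ 4 * c ^ 2 * i ^ 2"
    by (simp add: h_def di ds) algebra
  have "fps_deriv h ^ 2 = 4 * quartic k h"
    unfolding quartic_def dh dc m_def [symmetric] unfolding h_def using Di c2 by algebra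
  moreover have "fps_nth h 0 = 0"
    by (simp add: h_def s0)
  moreover have "fps_nth (fps_deriv h) 0 = 2"
    by (simp add: dh s0 c0 i0 power2_eq_square fps_nth_power_0)
  ultimately have "h = Theta k oo (fps_const 2 * fps_X)"
    by (intro Theta_double_unique) simp_all
  moreover have "h = 2 * (s * c / (1 - m * s ^ 4))"
    by (subst fps_divide_unit) (simp_all only: D0 h_def i_def mult_ac one_neq_zero not_False_eq_True)
  ultimately show ?thesis
    by (simp add: s_def c_def m_def)
qed

text \<open>By the quotient rule, \<open>f / f'\<close> has derivative \<open>E / f'^2\<close>;
  dividing \<open>f / f'\<close> by this leaves one factor \<open>f'\<close> in the
  numerator.\<close>

lemma T_op_T_op:
  assumes "f \<in> normalized_fps"
  shows "T_op (T_op f) = f * fps_deriv f / (fps_deriv f ^ 2 - f * fps_deriv (fps_deriv f))"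
proof -
  define c i where "c = fps_deriv f" and "i = inverse c"
  define E where "E = c ^ 2 - f * fps_deriv c"
  have f0: "fps_nth f 0 = 0" and c0: "fps_nth c 0 = 1"
    using assms by (simp_all add: c_def normalized_fps_def)
  have ci: "c * i = 1"
    unfolding i_def by (rule inverse_mult_eq_1') (simp add: c0)
  have E0: "fps_nth E 0 = 1"
    by (simp add: E_def f0 c0 power2_eq_square)
  have Tf: "T_op f = f * i"
    by (simp add: T_op_def c_def [symmetric] i_def fps_divide_unit c0)
  have "fps_deriv (c * i) = 0"
    by (simp add: ci)
  then have "fps_deriv c * i + c * fps_deriv i = 0"
    by (simp add: algebra_simps)
  then have dT: "fps_deriv (f * i) = E * i ^ 2"
    using ci unfolding E_def by (simp add: c_def [symmetric]) algebra
  have "E * inverse E = 1"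
    by (rule inverse_mult_eq_1') (simp add: E0)
  with ci have "E * i ^ 2 * (c ^ 2 * inverse E) = 1"
    by algebra
  then have "inverse (E * i ^ 2) = c ^ 2 * inverse E"
    by (metis fps_inverse_unique)
  moreover have "fps_nth (E * i ^ 2) 0 \<noteq> 0"
    using E0 c0 by (simp add: i_def fps_nth_power_0)
  ultimately have "T_op (T_op f) = f * i * (c ^ 2 * inverse E)"
    unfolding Tf by (simp only: T_op_def dT fps_divide_unit not_False_eq_True)
  also have "\<dots> = f * c * inverse E"
    using ci by algebra
  finally show ?thesis
    using E0 by (simp add: E_def c_def fps_divide_unit)
qed

theorem theorem1p1:
  fixes k :: complex
  shows "(T_op ^^ 2) (Theta k) = (Theta k oo (fps_const 2 * fps_X)) / fps_const 2"
proof -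
  define s c m where "s = Theta k" and "c = fps_deriv s" and "m = fps_const (k ^ 2)"
  have c2: "c ^ 2 = (1 - s ^ 2) * (1 - m * s ^ 2)"
    using deriv_Theta_square by (simp add: c_def s_def m_def quartic_def)
  have dc: "fps_deriv c = 2 * m * s ^ 3 - (1 + m) * s"
    by (simp add: c_def s_def m_def deriv2_Theta)
  \<comment> \<open>The terms in \<open>s ^ 2\<close> cancel, leaving exactly the denominator of the
    duplication formula.\<close>
  have "c ^ 2 - s * fps_deriv c = 1 - m * s ^ 4"
    unfolding c2 dc by algebra
  then have "(T_op ^^ 2) (Theta k) = s * c / (1 - m * s ^ 4)"
    using T_op_T_op [OF Theta_normalized, of k] by (simp add: numeral_2_eq_2 s_def c_def)
  moreover have "(2 * g) / fps_const 2 = g" for g :: "complex fps"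
    by (simp add: fps_divide_unit fps_const_inverse numeral_fps_const mult.commute
        mult.left_commute)
  ultimately show ?thesis
    unfolding Theta_double by (simp add: s_def c_def m_def)
qed

end
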